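(* Let $1\le p<\infty$ and let $\mathcal F\subseteq\Lambda^p(\mathbb R^n)$. Then $\mathcal F$ is totally bounded in $\Lambda^p(\mathbb R^n)$ if and only if the following three conditions hold: (i) (truncated tail condition) $$\lim_{R\to\infty}\ \sup_{f\in\mathcal F}\int_{\{|x|>R\}}\min(|f(x)|,1)^p\,\mathrm dx=0;$$ (ii) (truncated translation condition) $$\lim_{|y|\to0}\ \sup_{f\in\mathcal F}\int_{\mathbb R^n}\min(|f(x+y)-f(x)|,1)^p\,\mathrm dx=0;$$ (iii) (almost equiboundedness) $$\lim_{M\to\infty}\ \sup_{f\in\mathcal F}\big|\{|f|>M\}\big|=0.$$
   Context: $\mathbb R^n$ carries Lebesgue measure, and $|A|$ denotes the Lebesgue measure of a measurable set $A$. For $1\le p<\infty$, $\Lambda^p(\mathbb R^n)$ is the set of measurable functions $f:\mathbb R^n\to\mathbb R$ with $\int_{\mathbb R^n}\min(|f|,1)^p\,\mathrm dx<\infty$, where functions agreeing almost everywhere are identified. It is a vector space, equipped with the translation-invariant metric $(f,g)\mapsto\|\min(|f-g|,1)\|_p$, where $\|\cdot\|_p$ is the $L^p(\mathbb R^n)$ norm; total boundedness is with respect to this metric. *)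

theory Defs
  imports "HOL-Analysis.Analysis"
begin

definition Lambda_fun :: "real \<Rightarrow> ('a::euclidean_space \<Rightarrow> real) set" where
  "Lambda_fun p = {f \<in> borel_measurable lebesgue.
     (\<integral>\<^sup>+x. ennreal (min \<bar>f x\<bar> 1 powr p) \<partial>lebesgue) < \<infinity>}"

definition ae_equal :: "(('a::euclidean_space \<Rightarrow> real) \<times> ('a \<Rightarrow> real)) set" where
  "ae_equal = {(f, g). f \<in> borel_measurable lebesgue \<and> g \<in> borel_measurable lebesgue
     \<and> (AE x in lebesgue. f x = g x)}"

text \<open>The elements of \<open>\<Lambda>\<^sup>p\<close> are equivalence classes of functions; a class is evaluated
  through a representative, the choice of which is immaterial by \<open>AE_rep\<close> below.\<close>

definition Lambda :: "real \<Rightarrow> ('a::euclidean_space \<Rightarrow> real) set set" where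
  "Lambda p = Lambda_fun p // ae_equal"

definition rep :: "('a::euclidean_space \<Rightarrow> real) set \<Rightarrow> 'a \<Rightarrow> real" where
  "rep F = (SOME f. f \<in> F)"

definition Lp_norm :: "real \<Rightarrow> ('a::euclidean_space \<Rightarrow> real) \<Rightarrow> real" where
  "Lp_norm p u = enn2real (\<integral>\<^sup>+x. ennreal (\<bar>u x\<bar> powr p) \<partial>lebesgue) powr (1 / p)"

definition Lambda_dist ::
  "real \<Rightarrow> ('a::euclidean_space \<Rightarrow> real) set \<Rightarrow> ('a \<Rightarrow> real) set \<Rightarrow> real" where
  "Lambda_dist p F G = Lp_norm p (\<lambda>x. min \<bar>rep F x - rep G x\<bar> 1)"

lemma equiv_ae_equal: "equiv (borel_measurable lebesgue) ae_equal"
proof (rule equivI)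
  show "refl_on (borel_measurable lebesgue) ae_equal"
    by (auto simp: refl_on_def ae_equal_def)
  show "sym ae_equal" by (auto simp: sym_def ae_equal_def elim: eventually_mono)
  show "trans ae_equal" by (auto simp: trans_def ae_equal_def elim: eventually_elim2)
qed (auto simp: ae_equal_def)

lemma Lambda_cases:
  assumes "F \<in> Lambda p"
  obtains f where "f \<in> Lambda_fun p" "F = ae_equal `` {f}" "f \<in> F"
  using assms
  by (auto simp: Lambda_def quotient_def ae_equal_def Lambda_fun_def)

lemma rep_in: "F \<in> Lambda p \<Longrightarrow> rep F \<in> F"
  unfolding rep_def by (metis Lambda_cases someI_ex)

lemma AE_rep:
  assumes "F \<in> Lambda p" "f \<in> F"
  shows "AE x in lebesgue. rep F x = f x"
proof -
  obtain g where g: "F = ae_equal `` {g}" using assms(1) by (rule Lambda_cases)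
  have "AE x in lebesgue. g x = rep F x" "AE x in lebesgue. g x = f x"
    using rep_in[OF assms(1)] assms(2) unfolding g by (auto simp: ae_equal_def)
  then show ?thesis by eventually_elim simp
qed

lemma Lambda_subset:
  assumes "F \<in> Lambda p" shows "F \<subseteq> Lambda_fun p"
proof
  fix h assume h: "h \<in> F"
  obtain f where f: "f \<in> Lambda_fun p" "F = ae_equal `` {f}" using assms by (rule Lambda_cases)
  have m: "h \<in> borel_measurable lebesgue" and e: "AE x in lebesgue. f x = h x"
    using h f by (auto simp: ae_equal_def)
  have "(\<integral>\<^sup>+x. ennreal (min \<bar>h x\<bar> 1 powr p) \<partial>lebesgue)
      = (\<integral>\<^sup>+x. ennreal (min \<bar>f x\<bar> 1 powr p) \<partial>lebesgue)"
    using e by (intro nn_integral_cong_AE) (auto elim: eventually_mono)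
  then show "h \<in> Lambda_fun p" using f m by (auto simp: Lambda_fun_def)
qed

lemma Lambda_eqI:
  assumes "F \<in> Lambda p" "G \<in> Lambda p" "AE x in lebesgue. rep F x = rep G x"
  shows "F = G"
proof -
  obtain f where f: "f \<in> Lambda_fun p" "F = ae_equal `` {f}" using assms(1) by (rule Lambda_cases)
  obtain g where g: "g \<in> Lambda_fun p" "G = ae_equal `` {g}" using assms(2) by (rule Lambda_cases)
  have 1: "(f, rep F) \<in> ae_equal" "(g, rep G) \<in> ae_equal"
    using rep_in[OF assms(1)] rep_in[OF assms(2)] f g by auto
  have "AE x in lebesgue. f x = rep F x" "AE x in lebesgue. g x = rep G x"
    using 1 by (auto simp: ae_equal_def)
  with assms(3) have "AE x in lebesgue. f x = g x" by eventually_elim simp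
  then have "(f, g) \<in> ae_equal" using 1 by (auto simp: ae_equal_def)
  then show ?thesis using f g equiv_class_eq[OF equiv_ae_equal] by simp
qed

lemma powr_convex_comb:
  fixes u v l p :: real
  assumes "1 \<le> p" "0 \<le> u" "0 \<le> v" "0 < l" "l < 1"
  shows "(l * u + (1 - l) * v) powr p \<le> l * u powr p + (1 - l) * v powr p"
proof (cases "u = 0 \<or> v = 0")
  case False
  then show ?thesis
    using convex_onD[OF powr_convex[OF assms(1)], of "1 - l" u v] assms
    by (simp add: algebra_simps)
next
  case True
  have a: "t powr p \<le> t" if "0 < t" "t < 1" for t :: real
    using powr_mono'[of 1 p t] that assms by simp
  have "(t * w) powr p \<le> t * w powr p" if "0 < t" "t < 1" "0 \<le> w" for t w :: real
    using mult_right_mono[OF a[OF that(1,2)], of "w powr p"] that by (simp add: powr_mult)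
  from this[of l u] this[of "1 - l" v] True assms show ?thesis by auto
qed

lemma Lp_norm_triangle:
  fixes u v w :: "'a::euclidean_space \<Rightarrow> real"
  assumes p: "1 \<le> p"
    and [measurable]: "u \<in> borel_measurable lebesgue" "v \<in> borel_measurable lebesgue"
    and le: "\<And>x. 0 \<le> u x" "\<And>x. 0 \<le> v x" "\<And>x. 0 \<le> w x" "\<And>x. w x \<le> u x + v x"
    and fin: "(\<integral>\<^sup>+x. ennreal (\<bar>u x\<bar> powr p) \<partial>lebesgue) < \<infinity>"
      "(\<integral>\<^sup>+x. ennreal (\<bar>v x\<bar> powr p) \<partial>lebesgue) < \<infinity>"
  shows "Lp_norm p w \<le> Lp_norm p u + Lp_norm p v"
proof (rule field_le_epsilon)
  fix e :: real assume e: "0 < e"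
  define a where "a = Lp_norm p u + e / 2"
  define b where "b = Lp_norm p v + e / 2"
  have nn: "0 \<le> Lp_norm p u" "0 \<le> Lp_norm p v" by (auto simp: Lp_norm_def)
  then have ab: "0 < a" "0 < b" using e by (auto simp: a_def b_def)
  have bound: "(\<integral>\<^sup>+x. ennreal (\<bar>h x\<bar> powr p) \<partial>lebesgue) \<le> ennreal (c powr p)"
    if "(\<integral>\<^sup>+x. ennreal (\<bar>h x\<bar> powr p) \<partial>lebesgue) < \<infinity>" "Lp_norm p h \<le> c"
    for h :: "'a \<Rightarrow> real" and c
  proof -
    let ?I = "(\<integral>\<^sup>+x. ennreal (\<bar>h x\<bar> powr p) \<partial>lebesgue)"
    have "enn2real ?I = Lp_norm p h powr p"
      using p by (simp add: Lp_norm_def powr_powr)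
    also have "\<dots> \<le> c powr p" using that p by (intro powr_mono2) (auto simp: Lp_norm_def)
    finally show ?thesis using that(1)
      by (metis ennreal_enn2real ennreal_leI infinity_ennreal_def)
  qed
  define l where "l = a / (a + b)"
  have l: "0 < l" "l < 1" "1 - l = b / (a + b)" using ab by (auto simp: l_def field_simps)
  define A where "A = (a + b) powr p * l / a powr p"
  define B where "B = (a + b) powr p * (1 - l) / b powr p"
  have AB: "0 \<le> A" "0 \<le> B" using l(1,2) by (simp_all add: A_def B_def)
  have pt: "\<bar>w x\<bar> powr p \<le> A * \<bar>u x\<bar> powr p + B * \<bar>v x\<bar> powr p" for x
  proof -
    have "\<bar>w x\<bar> powr p \<le> (u x + v x) powr p" using le p by (intro powr_mono2) auto
    also have "u x + v x = (a + b) * (l * (u x / a) + (1 - l) * (v x / b))"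
    proof -
      have "l * (u x / a) = u x / (a + b)" "(1 - l) * (v x / b) = v x / (a + b)"
        unfolding l(3) using ab by (simp_all add: l_def)
      then show ?thesis using ab by (simp add: add_divide_distrib[symmetric])
    qed
    also have "\<dots> powr p = (a + b) powr p * (l * (u x / a) + (1 - l) * (v x / b)) powr p"
      using ab l le by (intro powr_mult)
    also have "\<dots> \<le> (a + b) powr p * (l * (u x / a) powr p + (1 - l) * (v x / b) powr p)"
      using ab l le p by (intro mult_left_mono powr_convex_comb) auto
    also have "\<dots> = A * \<bar>u x\<bar> powr p + B * \<bar>v x\<bar> powr p"
      using ab le by (simp add: A_def B_def powr_divide algebra_simps)
    finally show ?thesis .
  qed
  have "(\<integral>\<^sup>+x. ennreal (\<bar>w x\<bar> powr p) \<partial>lebesgue)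
      \<le> (\<integral>\<^sup>+x. ennreal A * ennreal (\<bar>u x\<bar> powr p) + ennreal B * ennreal (\<bar>v x\<bar> powr p) \<partial>lebesgue)"
    using pt AB by (intro nn_integral_mono) (simp add: ennreal_mult[symmetric] ennreal_plus[symmetric] del: ennreal_plus)
  also have "\<dots> = ennreal A * (\<integral>\<^sup>+x. ennreal (\<bar>u x\<bar> powr p) \<partial>lebesgue)
      + ennreal B * (\<integral>\<^sup>+x. ennreal (\<bar>v x\<bar> powr p) \<partial>lebesgue)"
    by (subst nn_integral_add) (auto simp: nn_integral_cmult)
  also have "\<dots> \<le> ennreal A * ennreal (a powr p) + ennreal B * ennreal (b powr p)"
    using e by (intro add_mono mult_left_mono bound fin) (auto simp: a_def b_def)
  also have "\<dots> = ennreal (A * a powr p + B * b powr p)"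
    using AB by (simp add: ennreal_mult)
  also have "A * a powr p + B * b powr p = (a + b) powr p"
  proof -
    have "A * a powr p = (a + b) powr p * l" "B * b powr p = (a + b) powr p * (1 - l)"
      using ab by (simp_all add: A_def B_def)
    then show ?thesis by (simp add: algebra_simps)
  qed
  finally have "enn2real (\<integral>\<^sup>+x. ennreal (\<bar>w x\<bar> powr p) \<partial>lebesgue) \<le> (a + b) powr p"
    by (simp add: enn2real_leI)
  then have "Lp_norm p w \<le> ((a + b) powr p) powr (1 / p)"
    unfolding Lp_norm_def using p by (intro powr_mono2) auto
  also have "\<dots> = a + b" using p ab by (simp add: powr_powr)
  finally show "Lp_norm p w \<le> Lp_norm p u + Lp_norm p v + e" by (simp add: a_def b_def)
qed

lemma Lambda_fun_diff:
  assumes p: "1 \<le> p" and f: "f \<in> Lambda_fun p" and g: "g \<in> Lambda_fun p"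
  shows "(\<integral>\<^sup>+x. ennreal (min \<bar>f x - g x\<bar> 1 powr p) \<partial>lebesgue) < \<infinity>"
proof -
  have [measurable]: "f \<in> borel_measurable lebesgue" "g \<in> borel_measurable lebesgue"
    using f g by (auto simp: Lambda_fun_def)
  have pt: "min \<bar>f x - g x\<bar> 1 powr p \<le> 2 powr p * (min \<bar>f x\<bar> 1 powr p + min \<bar>g x\<bar> 1 powr p)" for x
  proof -
    have "min \<bar>f x - g x\<bar> 1 powr p \<le> (2 * max (min \<bar>f x\<bar> 1) (min \<bar>g x\<bar> 1)) powr p"
      using p by (intro powr_mono2) auto
    also have "\<dots> = 2 powr p * max (min \<bar>f x\<bar> 1) (min \<bar>g x\<bar> 1) powr p"
      by (intro powr_mult)
    also have "\<dots> \<le> 2 powr p * (min \<bar>f x\<bar> 1 powr p + min \<bar>g x\<bar> 1 powr p)"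
      by (intro mult_left_mono) (auto simp: max_def)
    finally show ?thesis .
  qed
  have "(\<integral>\<^sup>+x. ennreal (min \<bar>f x - g x\<bar> 1 powr p) \<partial>lebesgue)
     \<le> (\<integral>\<^sup>+x. ennreal (2 powr p) * (ennreal (min \<bar>f x\<bar> 1 powr p) + ennreal (min \<bar>g x\<bar> 1 powr p)) \<partial>lebesgue)"
    using pt by (intro nn_integral_mono) (simp add: ennreal_mult[symmetric] ennreal_plus[symmetric] del: ennreal_plus)
  also have "\<dots> = ennreal (2 powr p) * ((\<integral>\<^sup>+x. ennreal (min \<bar>f x\<bar> 1 powr p) \<partial>lebesgue)
      + (\<integral>\<^sup>+x. ennreal (min \<bar>g x\<bar> 1 powr p) \<partial>lebesgue))"
    by (simp add: nn_integral_cmult nn_integral_add)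
  also have "\<dots> < \<infinity>"
    using f g by (auto simp: Lambda_fun_def ennreal_mult_less_top)
  finally show ?thesis .
qed

lemma Metric_space_Lambda:
  assumes p: "1 \<le> p"
  shows "Metric_space (Lambda p :: ('a::euclidean_space \<Rightarrow> real) set set) (Lambda_dist p)"
proof
  fix F G H :: "('a \<Rightarrow> real) set"
  show "0 \<le> Lambda_dist p F G" by (simp add: Lambda_dist_def Lp_norm_def)
  show "Lambda_dist p F G = Lambda_dist p G F"
    by (simp add: Lambda_dist_def abs_minus_commute)
  have mem: "rep F \<in> Lambda_fun p" "rep F \<in> borel_measurable lebesgue"
    if "F \<in> Lambda p" for F :: "('a \<Rightarrow> real) set"
    using rep_in[OF that] Lambda_subset[OF that] by (auto simp: Lambda_fun_def)
  show "Lambda_dist p F G = 0 \<longleftrightarrow> F = G" if F: "F \<in> Lambda p" and G: "G \<in> Lambda p"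
  proof
    assume "F = G"
    then show "Lambda_dist p F G = 0" using p by (simp add: Lambda_dist_def Lp_norm_def)
  next
    have [measurable]: "rep F \<in> borel_measurable lebesgue" "rep G \<in> borel_measurable lebesgue"
      using mem F G by auto
    assume "Lambda_dist p F G = 0"
    then have "(\<integral>\<^sup>+x. ennreal (min \<bar>rep F x - rep G x\<bar> 1 powr p) \<partial>lebesgue) = 0"
      using Lambda_fun_diff[OF p mem(1)[OF F] mem(1)[OF G]]
      by (auto simp: Lambda_dist_def Lp_norm_def enn2real_eq_0_iff)
    then have "AE x in lebesgue. ennreal (min \<bar>rep F x - rep G x\<bar> 1 powr p) = 0"
      by (subst (asm) nn_integral_0_iff_AE) auto
    then have "AE x in lebesgue. rep F x = rep G x"
      by eventually_elim (auto simp: ennreal_eq_0_iff min_def split: if_splits)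
    then show "F = G" by (rule Lambda_eqI[OF F G])
  qed
  show "Lambda_dist p F H \<le> Lambda_dist p F G + Lambda_dist p G H"
    if F: "F \<in> Lambda p" and G: "G \<in> Lambda p" and H: "H \<in> Lambda p"
  proof -
    have [measurable]: "rep F \<in> borel_measurable lebesgue" "rep G \<in> borel_measurable lebesgue"
       "rep H \<in> borel_measurable lebesgue"
      using mem F G H by auto
    show ?thesis
      unfolding Lambda_dist_def
      using Lambda_fun_diff[OF p mem(1)[OF F] mem(1)[OF G]]
        Lambda_fun_diff[OF p mem(1)[OF G] mem(1)[OF H]]
      by (intro Lp_norm_triangle[OF p]) auto
  qed
qed

end

theory Submission
  imports Defs
begin

text \<open>Necessity: each of the three conditions holds for a single function, and a finite net
  transfers it to the whole family.  For translations of a single function, an almost everywhere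
  limit of continuous functions and dominated convergence on balls suffice.

  Sufficiency: by (iii) the functions may be clipped to a common interval \<open>[-M, M]\<close>, which only
  decreases the quantities in (i) and (ii).  A clipped function \<open>f\<close> is close to a step function
  \<open>x \<mapsto> f (k x + y)\<close>, where \<open>k x\<close> is the corner of the cube of a fine grid containing \<open>x\<close> and the
  offset \<open>y\<close>, depending on \<open>f\<close>, is found by averaging over the cube.  On a ball such a step function
  takes finitely many values in \<open>[-M, M]\<close>; rounding them leaves finitely many patterns, and
  functions with the same pattern are close to each other.\<close>

section \<open>The truncated power and its integral\<close>

text \<open>Values in \<open>ennreal\<close> keep the later estimates free of integrability side
  conditions.\<close>

definition tpow :: "real \<Rightarrow> real \<Rightarrow> ennreal" where
  "tpow p t = ennreal (min \<bar>t\<bar> 1 powr p)"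

text \<open>The p-th power of the distance to 0. Leaving out the root costs a constant in the
  triangle inequality but makes the functional additive over pieces of the domain. Integration is
  over \<open>lborel\<close> because the argument runs on Borel representatives.\<close>

definition modular :: "real \<Rightarrow> ('a::euclidean_space \<Rightarrow> real) \<Rightarrow> ennreal" where
  "modular p f = (\<integral>\<^sup>+x. tpow p (f x) \<partial>lborel)"

definition tail :: "real \<Rightarrow> real \<Rightarrow> ('a::euclidean_space \<Rightarrow> real) \<Rightarrow> ennreal" where
  "tail p R f = (\<integral>\<^sup>+x. tpow p (f x) * indicator {x. norm x > R} x \<partial>lborel)"

text \<open>The constant of the triangle inequality for p-th powers. It is not optimised: all that
  matters is that it is finite and depends on \<open>p\<close> alone.\<close>

definition quasi :: "real \<Rightarrow> ennreal" where
  "quasi p = ennreal (2 powr p)"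

lemma tpow_measurable [measurable]: "tpow p \<in> borel_measurable borel"
  unfolding tpow_def by measurable

lemma tpow_0 [simp]: "tpow p 0 = 0"
  by (simp add: tpow_def)

lemma tpow_minus [simp]: "tpow p (- t) = tpow p t"
  by (simp add: tpow_def)

lemma tpow_le_1: "1 \<le> p \<Longrightarrow> tpow p t \<le> 1"
  unfolding tpow_def ennreal_1[symmetric] by (intro ennreal_leI powr_le1) auto

lemma tpow_eq_1: "1 \<le> \<bar>t\<bar> \<Longrightarrow> tpow p t = 1"
  by (simp add: tpow_def)

lemma tpow_mono: "1 \<le> p \<Longrightarrow> \<bar>s\<bar> \<le> \<bar>t\<bar> \<Longrightarrow> tpow p s \<le> tpow p t"
  unfolding tpow_def by (intro ennreal_leI powr_mono2) auto

lemma tpow_minus_commute: "tpow p (a - b) = tpow p (b - a)"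
  by (simp add: tpow_def abs_minus_commute)

text \<open>A number in [0, 1] does not increase when raised to a power \<open>p\<close> that is at
  least 1. This linear bound later turns a rounding error into an integral estimate.\<close>

lemma tpow_le_abs:
  assumes "1 \<le> p" shows "tpow p t \<le> ennreal \<bar>t\<bar>"
proof -
  have "min \<bar>t\<bar> 1 powr p \<le> min \<bar>t\<bar> 1"
  proof (cases "t = 0")
    case False
    then show ?thesis using powr_mono'[of 1 p "min \<bar>t\<bar> 1"] assms by simp
  qed simp
  then show ?thesis unfolding tpow_def by (intro ennreal_leI) linarith
qed

lemma tpow_tendsto_0:
  assumes "1 \<le> p" "X \<longlonglongrightarrow> 0" shows "(\<lambda>n. tpow p (X n)) \<longlonglongrightarrow> 0"
proof (rule tendsto_sandwich[where f = "\<lambda>_. 0"])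
  show "(\<lambda>n. ennreal \<bar>X n\<bar>) \<longlonglongrightarrow> 0"
    using assms(2) by (subst ennreal_tendsto_0_iff) (auto intro: tendsto_rabs_zero)
  show "\<forall>\<^sub>F n in sequentially. tpow p (X n) \<le> ennreal \<bar>X n\<bar>"
    using tpow_le_abs[OF assms(1)] by simp
qed auto

text \<open>Truncation at 1 is subadditive, a sum is at most twice the larger term, and the p-th
  power of the larger term is one of the two summands.\<close>

lemma tpow_diff_triangle:
  assumes "1 \<le> p"
  shows "tpow p (a - c) \<le> quasi p * (tpow p (a - b) + tpow p (b - c))"
proof -
  have "min \<bar>a - c\<bar> 1 powr p \<le> (2 * max (min \<bar>a - b\<bar> 1) (min \<bar>b - c\<bar> 1)) powr p"
    using assms by (intro powr_mono2) (simp_all, smt (verit))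
  also have "\<dots> = 2 powr p * max (min \<bar>a - b\<bar> 1) (min \<bar>b - c\<bar> 1) powr p"
    by (intro powr_mult)
  also have "\<dots> \<le> 2 powr p * (min \<bar>a - b\<bar> 1 powr p + min \<bar>b - c\<bar> 1 powr p)"
    by (intro mult_left_mono) (auto simp: max_def)
  finally show ?thesis
    by (simp add: tpow_def quasi_def ennreal_mult[symmetric] ennreal_plus[symmetric] ennreal_leI del: ennreal_plus)
qed

lemma tpow_diff_le:
  assumes "1 \<le> p" "tpow p (a - b) \<le> s" "tpow p (b - c) \<le> t"
  shows "tpow p (a - c) \<le> quasi p * (s + t)"
  by (rule order_trans[OF tpow_diff_triangle[OF assms(1), of a c b]])
    (intro mult_left_mono add_mono assms(2,3), simp)

lemma quasi_less_top [simp]: "quasi p < top"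
  by (simp add: quasi_def)

lemma nn_integral_quasi_triangle:
  assumes [measurable]: "g \<in> borel_measurable M" "h \<in> borel_measurable M"
    and "\<And>x. f x \<le> quasi p * (g x + h x)"
  shows "(\<integral>\<^sup>+x. f x \<partial>M) \<le> quasi p * ((\<integral>\<^sup>+x. g x \<partial>M) + (\<integral>\<^sup>+x. h x \<partial>M))"
proof -
  have "(\<integral>\<^sup>+x. f x \<partial>M) \<le> (\<integral>\<^sup>+x. quasi p * (g x + h x) \<partial>M)"
    by (intro nn_integral_mono assms(3))
  also have "\<dots> = quasi p * ((\<integral>\<^sup>+x. g x \<partial>M) + (\<integral>\<^sup>+x. h x \<partial>M))"
    by (simp add: nn_integral_cmult nn_integral_add)
  finally show ?thesis .
qed

lemma modular_triangle:
  fixes f g h :: "'a::euclidean_space \<Rightarrow> real"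
  assumes "1 \<le> p" and [measurable]: "f \<in> borel_measurable borel" "g \<in> borel_measurable borel" "h \<in> borel_measurable borel"
  shows "modular p (\<lambda>x. f x - h x)
    \<le> quasi p * (modular p (\<lambda>x. f x - g x) + modular p (\<lambda>x. g x - h x))"
  unfolding modular_def
  by (rule nn_integral_quasi_triangle) (auto intro!: tpow_diff_triangle assms(1))

lemma modular_minus_commute: "modular p (\<lambda>x. f x - g x) = modular p (\<lambda>x. g x - f x)"
  unfolding modular_def by (subst tpow_minus_commute) simp

text \<open>Only the comparison function keeps the cutoff. The difference is integrated over the
  whole space, so its term does not depend on \<open>R\<close>, as the finite net argument
  demands.\<close>

lemma tail_triangle:
  fixes f g :: "'a::euclidean_space \<Rightarrow> real"
  assumes "1 \<le> p" and [measurable]: "f \<in> borel_measurable borel" "g \<in> borel_measurable borel"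
  shows "tail p R f \<le> quasi p * (modular p (\<lambda>x. f x - g x) + tail p R g)"
  unfolding modular_def tail_def
proof (rule nn_integral_quasi_triangle)
  fix x
  show "tpow p (f x) * indicator {x. norm x > R} x
      \<le> quasi p * (tpow p (f x - g x) + tpow p (g x) * indicator {x. norm x > R} x)"
    using tpow_diff_triangle[OF assms(1), of "f x" 0 "g x"] by (auto simp: indicator_def)
qed auto

lemma nn_integral_lborel_translate:
  fixes f :: "'a::euclidean_space \<Rightarrow> ennreal"
  assumes [measurable]: "f \<in> borel_measurable borel"
  shows "(\<integral>\<^sup>+x. f (x + y) \<partial>lborel) = (\<integral>\<^sup>+x. f x \<partial>lborel)"
proof -
  have "(\<integral>\<^sup>+x. f x \<partial>lborel) = (\<integral>\<^sup>+x. f x \<partial>distr lborel borel ((+) y))"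
    by (simp add: lborel_distr_plus)
  also have "\<dots> = (\<integral>\<^sup>+x. f (x + y) \<partial>lborel)"
    by (subst nn_integral_distr) (auto simp: add.commute)
  finally show ?thesis ..
qed

lemma modular_translate:
  fixes f :: "'a::euclidean_space \<Rightarrow> real"
  assumes [measurable]: "f \<in> borel_measurable borel"
  shows "modular p (\<lambda>x. f (x + y)) = modular p f"
  unfolding modular_def by (rule nn_integral_lborel_translate) measurable

section \<open>Limits of suprema over a family\<close>

text \<open>The free constant \<open>B\<close> absorbs the quasi-triangle constants.\<close>

lemma ennreal_arbitrarily_small:
  fixes B a :: ennreal
  assumes "B < \<infinity>" "0 < a"
  obtains e :: real where "0 < e" "B * ennreal e < a"
proof (cases "a = \<infinity>")
  case True
  then show ?thesis using that[of 1] assms by simp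
next
  case False
  obtain b where b: "B = ennreal b" "0 \<le> b" using assms(1) by (cases B) auto
  obtain c where c: "a = ennreal c" "0 < c" using assms(2) False by (cases a) auto
  have "b * (c / (b + 1)) < c" using b c by (simp add: field_simps)
  then show ?thesis using that[of "c / (b + 1)"] b c
    by (simp add: ennreal_mult[symmetric] ennreal_lessI)
qed

lemma ennreal_tendsto_0I:
  fixes f :: "'b \<Rightarrow> ennreal"
  assumes "B < \<infinity>" "\<And>e::real. 0 < e \<Longrightarrow> \<forall>\<^sub>F x in F. f x \<le> B * ennreal e"
  shows "(f \<longlongrightarrow> 0) F"
proof (rule order_tendstoI)
  fix a :: ennreal assume "0 < a"
  with assms(1) obtain e :: real where e: "0 < e" "B * ennreal e < a" by (rule ennreal_arbitrarily_small)
  show "\<forall>\<^sub>F x in F. f x < a"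
    using assms(2)[OF e(1)] by eventually_elim (use e in auto)
qed simp

text \<open>Unpacks the three conditions into bounds that hold eventually and uniformly over the
  family.\<close>

lemma SUP_tendsto_0_iff:
  fixes T :: "'r \<Rightarrow> 'i \<Rightarrow> ennreal"
  shows "((\<lambda>r. SUP i\<in>S. T r i) \<longlongrightarrow> 0) F
    \<longleftrightarrow> (\<forall>e::real>0. \<forall>\<^sub>F r in F. \<forall>i\<in>S. T r i \<le> ennreal e)"
proof
  assume L: "((\<lambda>r. SUP i\<in>S. T r i) \<longlongrightarrow> 0) F"
  show "\<forall>e::real>0. \<forall>\<^sub>F r in F. \<forall>i\<in>S. T r i \<le> ennreal e"
  proof (intro allI impI)
    fix e :: real assume "0 < e"
    then have "\<forall>\<^sub>F r in F. (SUP i\<in>S. T r i) < ennreal e"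
      by (intro order_tendstoD(2)[OF L]) simp
    then show "\<forall>\<^sub>F r in F. \<forall>i\<in>S. T r i \<le> ennreal e"
      by eventually_elim (meson SUP_upper less_imp_le order_trans)
  qed
next
  assume R: "\<forall>e::real>0. \<forall>\<^sub>F r in F. \<forall>i\<in>S. T r i \<le> ennreal e"
  show "((\<lambda>r. SUP i\<in>S. T r i) \<longlongrightarrow> 0) F"
    by (rule ennreal_tendsto_0I[where B = 1])
      (use R in \<open>auto intro!: SUP_least elim!: eventually_mono\<close>)
qed

text \<open>The common core of the necessity proofs. \<open>D\<close> is a distance that does not
  involve \<open>r\<close>, so each member can be exchanged for a net point at a small cost,
  uniformly in \<open>r\<close>; the finitely many net points are then small simultaneously.
  \<open>T'\<close> may differ from \<open>T\<close>, since the level condition loses a bit of its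
  level in the exchange.\<close>

lemma SUP_tendsto_0_finite_net:
  fixes T T' :: "'r \<Rightarrow> 'i \<Rightarrow> ennreal"
  assumes B: "B < \<infinity>"
    and net: "\<And>e::real. 0 < e \<Longrightarrow> \<exists>K. finite K \<and> K \<subseteq> S \<and> (\<forall>i\<in>S. \<exists>k\<in>K. D i k \<le> ennreal e)"
    and T': "\<And>k. k \<in> S \<Longrightarrow> ((\<lambda>r. T' r k) \<longlongrightarrow> 0) F"
    and T: "\<And>r i k. i \<in> S \<Longrightarrow> k \<in> S \<Longrightarrow> T r i \<le> B * (D i k + T' r k)"
  shows "((\<lambda>r. SUP i\<in>S. T r i) \<longlongrightarrow> 0) F"
proof (rule ennreal_tendsto_0I)
  show "B * 2 < \<infinity>" using B by (simp add: ennreal_mult_less_top)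
  fix e :: real assume e: "0 < e"
  obtain K where K: "finite K" "K \<subseteq> S" "\<And>i. i \<in> S \<Longrightarrow> \<exists>k\<in>K. D i k \<le> ennreal e"
    using net[OF e] by blast
  have "\<forall>\<^sub>F r in F. T' r k < ennreal e" if "k \<in> K" for k
    using order_tendstoD(2)[OF T', of k "ennreal e"] that K e by auto
  then have "\<forall>\<^sub>F r in F. \<forall>k\<in>K. T' r k < ennreal e"
    using K(1) by (simp add: eventually_ball_finite)
  then show "\<forall>\<^sub>F r in F. (SUP i\<in>S. T r i) \<le> B * 2 * ennreal e"
  proof eventually_elim
    case (elim r)
    show ?case
    proof (rule SUP_least)
      fix i assume i: "i \<in> S"
      obtain k where k: "k \<in> K" "D i k \<le> ennreal e" using K(3)[OF i] by blast
      have "T r i \<le> B * (D i k + T' r k)" using T i k K by blast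
      also have "\<dots> \<le> B * (ennreal e + ennreal e)"
        using k elim by (intro mult_left_mono add_mono) (auto intro: less_imp_le)
      finally show "T r i \<le> B * 2 * ennreal e" by (simp add: mult_2 mult.assoc)
    qed
  qed
qed

section \<open>The three conditions for a single function\<close>

lemma nn_integral_dominated_tendsto_0:
  fixes u :: "nat \<Rightarrow> 'a \<Rightarrow> ennreal"
  assumes "\<And>i. u i \<in> borel_measurable M" "w \<in> borel_measurable M"
    and "\<And>j x. u j x \<le> w x" "(\<integral>\<^sup>+x. w x \<partial>M) < \<infinity>"
    and "AE x in M. (\<lambda>i. u i x) \<longlonglongrightarrow> 0"
  shows "(\<lambda>i. (\<integral>\<^sup>+x. u i x \<partial>M)) \<longlonglongrightarrow> 0"
  using nn_integral_dominated_convergence[of u M "\<lambda>_. 0" w] assms by simp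

lemma tail_tendsto_0:
  fixes f :: "'a::euclidean_space \<Rightarrow> real"
  assumes [measurable]: "f \<in> borel_measurable borel" and fin: "modular p f < \<infinity>"
  shows "((\<lambda>R. tail p R f) \<longlongrightarrow> 0) at_top"
proof (rule tendsto_at_topI_sequentially)
  fix X :: "nat \<Rightarrow> real" assume X: "filterlim X at_top sequentially"
  show "(\<lambda>n. tail p (X n) f) \<longlonglongrightarrow> 0"
    unfolding tail_def
  proof (rule nn_integral_dominated_tendsto_0[where w = "\<lambda>x. tpow p (f x)"])
    show "AE x in lborel. (\<lambda>i. tpow p (f x) * indicator {x. X i < norm x} x) \<longlonglongrightarrow> 0"
    proof (rule AE_I2, rule tendsto_eventually)
      fix x :: 'a
      have "\<forall>\<^sub>F i in sequentially. norm x \<le> X i" using X by (auto simp: filterlim_at_top)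
      then show "\<forall>\<^sub>F i in sequentially. tpow p (f x) * indicator {x. X i < norm x} x = 0"
        by eventually_elim auto
    qed
  qed (use fin in \<open>auto simp: modular_def indicator_def\<close>)
qed

lemma superlevel_tendsto_0:
  fixes f :: "'a::euclidean_space \<Rightarrow> real"
  assumes [measurable]: "f \<in> borel_measurable borel" and fin: "modular p f < \<infinity>"
  shows "((\<lambda>M. emeasure lborel {x. \<bar>f x\<bar> > M}) \<longlongrightarrow> 0) at_top"
proof (rule tendsto_at_topI_sequentially)
  fix X :: "nat \<Rightarrow> real" assume X: "filterlim X at_top sequentially"
  \<comment> \<open>Below level 1 the superlevel set need not be dominated by
    \<open>tpow p (f x)\<close>; from level 1 on, \<open>tpow\<close> equals 1 on it. Raising the
    level to at least 1 does not affect the terms from some index on.\<close>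
  have "(\<lambda>n. \<integral>\<^sup>+x. indicator {x. \<bar>f x\<bar> > max (X n) 1} x \<partial>lborel) \<longlonglongrightarrow> 0"
  proof (rule nn_integral_dominated_tendsto_0[where w = "\<lambda>x. tpow p (f x)"])
    show "AE x in lborel. (\<lambda>i. indicator {x. \<bar>f x\<bar> > max (X i) 1} x :: ennreal) \<longlonglongrightarrow> 0"
    proof (rule AE_I2, rule tendsto_eventually)
      fix x :: 'a
      have "\<forall>\<^sub>F i in sequentially. \<bar>f x\<bar> \<le> X i" using X by (auto simp: filterlim_at_top)
      then show "\<forall>\<^sub>F i in sequentially. indicator {x. \<bar>f x\<bar> > max (X i) 1} x = (0 :: ennreal)"
        by eventually_elim (auto simp: indicator_def)
    qed
  qed (use fin in \<open>auto simp: modular_def indicator_def tpow_eq_1\<close>)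
  moreover have "\<forall>\<^sub>F n in sequentially. 1 \<le> X n" using X by (auto simp: filterlim_at_top)
  then have "\<forall>\<^sub>F n in sequentially. (\<integral>\<^sup>+x. indicator {x. \<bar>f x\<bar> > max (X n) 1} x \<partial>lborel)
      = emeasure lborel {x. \<bar>f x\<bar> > X n}"
    by eventually_elim (simp add: max_absorb1)
  ultimately show "(\<lambda>n. emeasure lborel {x. \<bar>f x\<bar> > X n}) \<longlonglongrightarrow> 0"
    by (rule Lim_transform_eventually)
qed

text \<open>Where \<open>f\<close> and \<open>g\<close> differ by at least 1, \<open>tpow\<close> of
  the difference is 1; elsewhere \<open>g\<close> exceeds \<open>M - 1\<close> in modulus as soon as
  \<open>f\<close> exceeds \<open>M\<close>.\<close>

lemma superlevel_le:
  fixes f g :: "'a::euclidean_space \<Rightarrow> real"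
  assumes [measurable]: "f \<in> borel_measurable borel" "g \<in> borel_measurable borel"
  shows "emeasure lborel {x. \<bar>f x\<bar> > M}
    \<le> modular p (\<lambda>x. f x - g x) + emeasure lborel {x. \<bar>g x\<bar> > M - 1}"
proof -
  have "emeasure lborel {x. \<bar>f x\<bar> > M} = (\<integral>\<^sup>+x. indicator {x. \<bar>f x\<bar> > M} x \<partial>lborel)" by simp
  also have "\<dots> \<le> (\<integral>\<^sup>+x. tpow p (f x - g x) + indicator {x. \<bar>g x\<bar> > M - 1} x \<partial>lborel)"
  proof (rule nn_integral_mono)
    fix x show "indicator {x. \<bar>f x\<bar> > M} x \<le> tpow p (f x - g x) + indicator {x. \<bar>g x\<bar> > M - 1} x"
      using tpow_eq_1[of "f x - g x" p] by (cases "1 \<le> \<bar>f x - g x\<bar>") (auto simp: indicator_def)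
  qed
  also have "\<dots> = modular p (\<lambda>x. f x - g x) + emeasure lborel {x. \<bar>g x\<bar> > M - 1}"
    by (subst nn_integral_add) (auto simp: modular_def)
  finally show ?thesis .
qed

lemma cball_sets_borel [measurable]: "cball c r \<in> sets borel"
  by (simp add: borel_closed)

text \<open>\<open>measurable_on\<close> presents \<open>f\<close> as an almost everywhere limit of
  continuous functions. Truncation bounds the integrand by 1, so on a ball dominated convergence
  applies however large \<open>f\<close> is.\<close>

lemma continuous_approximation:
  fixes f :: "'a::euclidean_space \<Rightarrow> real"
  assumes p: "1 \<le> p" and [measurable]: "f \<in> borel_measurable borel" and e: "0 < e"
  obtains g where "continuous_on UNIV g"
    "(\<integral>\<^sup>+x. tpow p (f x - g x) * indicator (cball 0 R) x \<partial>lborel) < e"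
proof -
  have "f \<in> borel_measurable (lebesgue_on UNIV)"
    by (simp add: lebesgue_on_UNIV_eq measurable_completion)
  then have "f measurable_on UNIV"
    by (intro lebesgue_measurable_imp_measurable_on) auto
  then obtain N :: "'a set" and g where N: "negligible N" and g: "\<And>n::nat. continuous_on UNIV (g n)"
    and lim: "\<And>x. x \<notin> N \<Longrightarrow> (\<lambda>n. g n x) \<longlonglongrightarrow> f x"
    unfolding measurable_on_def by auto
  have [measurable]: "g n \<in> borel_measurable borel" for n
    using g by (rule borel_measurable_continuous_onI)
  have "N \<in> null_sets lebesgue" using N by (simp add: negligible_iff_null_sets)
  then have "AE x in lborel. x \<notin> N"
    by (subst AE_completion_iff[symmetric]) (rule AE_not_in)
  have "(\<lambda>n. \<integral>\<^sup>+x. tpow p (f x - g n x) * indicator (cball 0 R) x \<partial>lborel) \<longlonglongrightarrow> 0"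
  proof (rule nn_integral_dominated_tendsto_0[where w = "indicator (cball 0 R)"])
    show "(\<integral>\<^sup>+x. indicator (cball 0 R) x \<partial>(lborel :: 'a measure)) < \<infinity>"
      using emeasure_lborel_cball_finite by simp
    show "AE x in lborel. (\<lambda>n. tpow p (f x - g n x) * indicator (cball 0 R) x) \<longlonglongrightarrow> 0"
      using \<open>AE x in lborel. x \<notin> N\<close>
    proof eventually_elim
      case (elim x)
      have "(\<lambda>n. f x - g n x) \<longlonglongrightarrow> f x - f x" by (intro tendsto_intros lim elim)
      then have "(\<lambda>n. tpow p (f x - g n x)) \<longlonglongrightarrow> 0" by (intro tpow_tendsto_0 p) simp
      then show ?case by (auto simp: indicator_def)
    qed
  qed (auto simp: indicator_def tpow_le_1[OF p])
  then have "\<forall>\<^sub>F n in sequentially. (\<integral>\<^sup>+x. tpow p (f x - g n x) * indicator (cball 0 R) x \<partial>lborel) < e"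
    using e by (rule order_tendstoD)
  then show ?thesis using that g by (auto simp: eventually_sequentially)
qed

text \<open>Continuity gives pointwise convergence along every sequence of shifts, and the indicator
  of the ball dominates.\<close>

lemma continuous_translation_tendsto_0:
  fixes g :: "'a::euclidean_space \<Rightarrow> real"
  assumes p: "1 \<le> p" and g: "continuous_on UNIV g"
  shows "((\<lambda>y. \<integral>\<^sup>+x. tpow p (g (x + y) - g x) * indicator (cball 0 R) x \<partial>lborel) \<longlongrightarrow> 0) (at 0)"
  unfolding tendsto_at_iff_sequentially comp_def
proof (intro allI impI)
  fix Y :: "nat \<Rightarrow> 'a" assume Y: "Y \<longlonglongrightarrow> 0"
  have [measurable]: "g \<in> borel_measurable borel"
    using g by (rule borel_measurable_continuous_onI)
  show "(\<lambda>n. \<integral>\<^sup>+x. tpow p (g (x + Y n) - g x) * indicator (cball 0 R) x \<partial>lborel) \<longlonglongrightarrow> 0"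
  proof (rule nn_integral_dominated_tendsto_0[where w = "indicator (cball 0 R)"])
    show "(\<integral>\<^sup>+x. indicator (cball 0 R) x \<partial>(lborel :: 'a measure)) < \<infinity>"
      using emeasure_lborel_cball_finite by simp
    show "AE x in lborel. (\<lambda>n. tpow p (g (x + Y n) - g x) * indicator (cball 0 R) x) \<longlonglongrightarrow> 0"
    proof (rule AE_I2)
      fix x
      have "isCont g x" using g by (simp add: continuous_on_eq_continuous_at)
      then have "(\<lambda>n. g (x + Y n)) \<longlonglongrightarrow> g x"
        by (rule isCont_tendsto_compose) (use tendsto_add[OF tendsto_const[of x] Y] in simp)
      from tendsto_diff[OF this tendsto_const[of "g x"]]
      have "(\<lambda>n. tpow p (g (x + Y n) - g x)) \<longlonglongrightarrow> 0" by (intro tpow_tendsto_0 p) simp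
      then show "(\<lambda>n. tpow p (g (x + Y n) - g x) * indicator (cball 0 R) x) \<longlonglongrightarrow> 0"
        by (auto simp: indicator_def)
    qed
  qed (auto simp: indicator_def tpow_le_1[OF p])
qed

text \<open>On a large ball \<open>f\<close> is replaced by a continuous \<open>g\<close>, at
  \<open>x + y\<close> and at \<open>x\<close>; off the ball both points lie in the region where the
  tail of \<open>f\<close> is small.\<close>

lemma translation_tendsto_0:
  fixes f :: "'a::euclidean_space \<Rightarrow> real"
  assumes p: "1 \<le> p" and f[measurable]: "f \<in> borel_measurable borel" and fin: "modular p f < \<infinity>"
  shows "((\<lambda>y. modular p (\<lambda>x. f (x + y) - f x)) \<longlongrightarrow> 0) (at 0)"
proof (rule ennreal_tendsto_0I)
  define C where "C = quasi p"
  show "C * (3 + 2 * C) < \<infinity>" by (simp add: C_def ennreal_mult_less_top)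
  fix e :: real assume e: "0 < e"
  then have "\<forall>\<^sub>F R in at_top. tail p R f < ennreal e"
    by (intro order_tendstoD[OF tail_tendsto_0[OF f fin]]) simp
  then obtain R where R: "tail p R f < ennreal e"
    by (auto simp: eventually_at_top_linorder)
  \<comment> \<open>Shifts will have norm below 1. The domain is split at radius
    \<open>R + 1\<close>: inside, \<open>x + y\<close> stays in the ball of radius
    \<open>R + 2\<close>, and outside, \<open>x + y\<close> still has norm above
    \<open>R\<close>.\<close>
  obtain g where g: "continuous_on UNIV g"
    and fg: "(\<integral>\<^sup>+x. tpow p (f x - g x) * indicator (cball 0 (R + 2)) x \<partial>lborel) < ennreal e"
    using continuous_approximation[OF p f, of "ennreal e" "R + 2"] e by auto
  have [measurable]: "g \<in> borel_measurable borel"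
    using g by (rule borel_measurable_continuous_onI)
  define w where "w x = tpow p (f x - g x) * indicator (cball 0 (R + 2)) x" for x
  define t where "t x = tpow p (f x) * indicator {x. norm x > R} x" for x
  have wt [measurable]: "w \<in> borel_measurable borel" "t \<in> borel_measurable borel"
    unfolding w_def t_def by measurable
  have "\<forall>\<^sub>F y in at 0. norm (y::'a) < 1"
    by (auto simp: eventually_at intro: exI[of _ 1])
  moreover have "\<forall>\<^sub>F y in at 0.
      (\<integral>\<^sup>+x. tpow p (g (x + y) - g x) * indicator (cball 0 (R + 1)) x \<partial>lborel) < ennreal e"
    using e by (intro order_tendstoD[OF continuous_translation_tendsto_0[OF p g]]) simp
  ultimately show "\<forall>\<^sub>F y in at 0. modular p (\<lambda>x. f (x + y) - f x) \<le> C * (3 + 2 * C) * ennreal e"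
  proof eventually_elim
    case (elim y)
    \<comment> \<open>The constant arises here: after integration the five terms are each at most
      \<open>e\<close>, giving \<open>C + 2 * C^2\<close> from the ball and \<open>2 * C\<close>
      from the tails.\<close>
    have pt: "tpow p (f (x + y) - f x) \<le> C * (w (x + y) + C * (tpow p (g (x + y) - g x) * indicator (cball 0 (R + 1)) x + w x))
        + C * (t (x + y) + t x)" for x
    proof (cases "norm x \<le> R + 1")
      case True
      then have "norm (x + y) \<le> R + 2" using norm_triangle_ineq[of x y] elim by simp
      then have "w (x + y) = tpow p (f (x + y) - g (x + y))" "w x = tpow p (g x - f x)"
        using True by (auto simp: w_def tpow_minus_commute[of p "g x"])
      moreover have "tpow p (f (x + y) - f x) \<le> C * (tpow p (f (x + y) - g (x + y)) + C * (tpow p (g (x + y) - g x) + tpow p (g x - f x)))"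
        unfolding C_def
        by (rule order_trans[OF tpow_diff_triangle[OF p, of _ _ "g (x + y)"]])
          (intro mult_left_mono add_left_mono tpow_diff_triangle p, simp)
      ultimately show ?thesis using True by (simp add: add_increasing2)
    next
      case False
      then have "norm (x + y) > R" using norm_triangle_ineq4[of "x + y" y] elim by simp
      then have "t (x + y) = tpow p (f (x + y) - 0)" "t x = tpow p (0 - f x)"
        using False by (auto simp: t_def)
      then show ?thesis
        using tpow_diff_triangle[OF p, of "f (x + y)" "f x" 0] by (simp add: C_def add_increasing)
    qed
    have "modular p (\<lambda>x. f (x + y) - f x) \<le> (\<integral>\<^sup>+x. C * (w (x + y)
        + C * (tpow p (g (x + y) - g x) * indicator (cball 0 (R + 1)) x + w x)) + C * (t (x + y) + t x) \<partial>lborel)"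
      unfolding modular_def by (intro nn_integral_mono pt)
    also have "\<dots> = C * ((\<integral>\<^sup>+x. w x \<partial>lborel)
        + C * ((\<integral>\<^sup>+x. tpow p (g (x + y) - g x) * indicator (cball 0 (R + 1)) x \<partial>lborel) + (\<integral>\<^sup>+x. w x \<partial>lborel)))
        + C * ((\<integral>\<^sup>+x. t x \<partial>lborel) + (\<integral>\<^sup>+x. t x \<partial>lborel))"
      by (simp add: nn_integral_add nn_integral_cmult nn_integral_lborel_translate[OF wt(1)]
          nn_integral_lborel_translate[OF wt(2)])
    also have "\<dots> \<le> C * (ennreal e + C * (ennreal e + ennreal e)) + C * (ennreal e + ennreal e)"
      using fg R elim unfolding w_def t_def tail_def
      by (intro add_mono mult_left_mono) (auto intro: less_imp_le)
    also have "\<dots> = C * (3 + 2 * C) * ennreal e"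
    proof -
      have "a * 3 = a + a + a" "a * 2 = a + a" for a :: ennreal
        using distrib_left[of a 2 1] by (simp_all add: mult_2_right)
      then show ?thesis by (simp add: algebra_simps)
    qed
    finally show ?case .
  qed
qed

text \<open>The path runs from \<open>f (x + y)\<close> through \<open>g (x + y)\<close> and
  \<open>g x\<close> to \<open>f x\<close>. By translation invariance the first and last legs both
  cost the distance of \<open>f\<close> and \<open>g\<close>, which is independent of
  \<open>y\<close>.\<close>

lemma translation_triangle:
  fixes f g :: "'a::euclidean_space \<Rightarrow> real"
  assumes p: "1 \<le> p" and [measurable]: "f \<in> borel_measurable borel" "g \<in> borel_measurable borel"
  shows "modular p (\<lambda>x. f (x + y) - f x)
    \<le> quasi p * (1 + quasi p) * (modular p (\<lambda>x. f x - g x) + modular p (\<lambda>x. g (x + y) - g x))"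
proof -
  let ?d = "modular p (\<lambda>x. f x - g x)" and ?t = "modular p (\<lambda>x. g (x + y) - g x)"
  have "modular p (\<lambda>x. f (x + y) - f x)
      \<le> quasi p * (modular p (\<lambda>x. f (x + y) - g (x + y)) + modular p (\<lambda>x. g (x + y) - f x))"
    by (rule modular_triangle[OF p]) measurable
  also have "modular p (\<lambda>x. f (x + y) - g (x + y)) = ?d"
    by (rule modular_translate[of "\<lambda>x. f x - g x"]) measurable
  also have "modular p (\<lambda>x. g (x + y) - f x) \<le> quasi p * (?t + modular p (\<lambda>x. g x - f x))"
    by (rule modular_triangle[OF p]) measurable
  also have "modular p (\<lambda>x. g x - f x) = ?d" by (rule modular_minus_commute)
  finally have "modular p (\<lambda>x. f (x + y) - f x) \<le> quasi p * (?d + quasi p * (?t + ?d))"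
    by (simp add: mult_left_mono)
  \<comment> \<open>The added term is there only to give both moduli the same factor.\<close>
  also have "\<dots> \<le> quasi p * (?d + quasi p * (?t + ?d)) + quasi p * ?t" by (rule add_increasing2) simp_all
  also have "\<dots> = quasi p * (1 + quasi p) * (?d + ?t)" by (simp add: algebra_simps)
  finally show ?thesis .
qed

section \<open>Sampling on a grid of cubes\<close>

text \<open>The map \<open>k\<close> of the sketch: rounding every coordinate down to a multiple of
  \<open>h\<close> yields the lower corner of the half-open cube containing
  \<open>x\<close>.\<close>

definition grid :: "real \<Rightarrow> 'a::euclidean_space \<Rightarrow> 'a" where
  "grid h x = (\<Sum>b\<in>Basis. (h * of_int \<lfloor>(x \<bullet> b) / h\<rfloor>) *\<^sub>R b)"

lemma grid_measurable [measurable]: "grid h \<in> borel_measurable borel"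
  unfolding grid_def by measurable

lemma grid_inner: "b \<in> Basis \<Longrightarrow> grid h x \<bullet> b = h * of_int \<lfloor>(x \<bullet> b) / h\<rfloor>"
  by (simp add: grid_def inner_sum_left_Basis)

lemma diff_grid:
  assumes "0 < h" "b \<in> Basis"
  shows "0 \<le> (x - grid h x) \<bullet> b" "(x - grid h x) \<bullet> b < h"
proof -
  show "0 \<le> (x - grid h x) \<bullet> b" "(x - grid h x) \<bullet> b < h"
    using floor_divide_lower[OF assms(1), of "x \<bullet> b"] floor_divide_upper[OF assms(1), of "x \<bullet> b"] assms(2)
    by (simp_all add: inner_diff_left grid_inner algebra_simps)
qed

text \<open>A corner is determined by an integer vector whose entries are bounded in terms of
  \<open>R / h\<close>.\<close>

lemma finite_grid_cball:
  assumes "0 < h" shows "finite (grid h ` cball (0::'a::euclidean_space) R)"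
proof (rule finite_subset)
  let ?I = "PiE (Basis :: 'a set) (\<lambda>_. {\<lfloor>- R / h\<rfloor>..\<lfloor>R / h\<rfloor>})"
  show "finite ((\<lambda>n. \<Sum>b\<in>Basis. (h * of_int (n b)) *\<^sub>R b) ` ?I)"
    by (intro finite_imageI finite_PiE) auto
  show "grid h ` cball 0 R \<subseteq> (\<lambda>n. \<Sum>b\<in>Basis. (h * of_int (n b)) *\<^sub>R b) ` ?I"
  proof (rule image_subsetI)
    fix x :: 'a assume "x \<in> cball 0 R"
    then have "- R \<le> x \<bullet> b \<and> x \<bullet> b \<le> R" if "b \<in> Basis" for b
      using Basis_le_norm[OF that, of x] by (simp, linarith)
    then have "- R / h \<le> (x \<bullet> b) / h \<and> (x \<bullet> b) / h \<le> R / h" if "b \<in> Basis" for b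
      using that assms by (metis divide_right_mono less_imp_le)
    then have "(\<lambda>b\<in>Basis. \<lfloor>(x \<bullet> b) / h\<rfloor>) \<in> ?I"
      by (intro PiE_I) (auto intro!: floor_mono simp del: minus_divide_left)
    then show "grid h x \<in> (\<lambda>n. \<Sum>b\<in>Basis. (h * of_int (n b)) *\<^sub>R b) ` ?I"
      by (rule rev_image_eqI) (simp add: grid_def)
  qed
qed

text \<open>Averaging over the offset \<open>y\<close> bounds the mean error of the step functions by the translation
  moduli, so some offset does at least as well up to a factor.  Unlike convolution, this needs no
  integrability of \<open>f\<close> itself.\<close>

lemma grid_sampling:
  fixes f :: "'a::euclidean_space \<Rightarrow> real"
  assumes [measurable]: "f \<in> borel_measurable borel" and h: "0 < h" and e: "0 < e"
    and tr: "\<And>z. z \<in> box (- (h *\<^sub>R One)) (h *\<^sub>R One) \<Longrightarrow> modular p (\<lambda>x. f (x + z) - f x) \<le> ennreal e"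
  obtains y where "modular p (\<lambda>x. f x - f (grid h x + y)) \<le> 2 * 2 ^ DIM('a) * ennreal e"
proof (rule ccontr)
  let ?Q = "box 0 (h *\<^sub>R One) :: 'a set" and ?Q' = "box (- (h *\<^sub>R One)) (h *\<^sub>R One) :: 'a set"
  let ?c = "2 ^ DIM('a) * ennreal e"
  \<comment> \<open>If every offset fails, integrating over the offsets in \<open>?Q\<close> bounds
    twice a number by that number, which is finite and positive. The factor 2 in the claim makes
    this a contradiction without strict inequality of integrals.\<close>
  assume "\<not> thesis"
  then have gt: "2 * ?c < modular p (\<lambda>x. f x - f (grid h x + y))" for y
    using that[of y] by (force simp: mult.assoc not_le[symmetric])
  have Q: "emeasure lborel ?Q = ennreal (h ^ DIM('a))"
    using h by (subst emeasure_lborel_box) auto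
  \<comment> \<open>This volume ratio is the source of the factor
    \<open>2 ^ DIM('a)\<close>.\<close>
  have Q': "emeasure lborel ?Q' = 2 ^ DIM('a) * ennreal (h ^ DIM('a))"
  proof -
    have "(\<Prod>b\<in>(Basis :: 'a set). (h *\<^sub>R One - - (h *\<^sub>R One)) \<bullet> b) = (\<Prod>b\<in>(Basis :: 'a set). 2 * h)"
      by (intro prod.cong) (auto simp: inner_diff_left inner_add_left)
    then show ?thesis
      using h by (subst emeasure_lborel_box)
        (auto simp: ennreal_mult power_mult_distrib ennreal_power[symmetric])
  qed
  have "2 * ?c * ennreal (h ^ DIM('a)) = (\<integral>\<^sup>+y. 2 * ?c * indicator ?Q y \<partial>lborel)"
    by (simp add: nn_integral_cmult_indicator Q)
  also have "\<dots> \<le> (\<integral>\<^sup>+y. modular p (\<lambda>x. f x - f (grid h x + y)) * indicator ?Q y \<partial>lborel)"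
    by (intro nn_integral_mono mult_right_mono[OF less_imp_le[OF gt]]) simp
  also have "\<dots> = (\<integral>\<^sup>+y. \<integral>\<^sup>+x. tpow p (f x - f (grid h x + y)) * indicator ?Q y \<partial>lborel \<partial>lborel)"
    unfolding modular_def by (intro nn_integral_cong nn_integral_multc[symmetric]) measurable
  \<comment> \<open>The offset becomes the inner variable, so that the substitution that follows may
    depend on \<open>x\<close>.\<close>
  also have "\<dots> = (\<integral>\<^sup>+x. \<integral>\<^sup>+y. tpow p (f x - f (grid h x + y)) * indicator ?Q y \<partial>lborel \<partial>lborel)"
    by (rule lborel_pair.Fubini[where f = "\<lambda>(x, y). tpow p (f x - f (grid h x + y)) * indicator ?Q y", unfolded case_prod_conv])
      measurable
  also have "\<dots> \<le> (\<integral>\<^sup>+x. \<integral>\<^sup>+z. tpow p (f (x + z) - f x) * indicator ?Q' z \<partial>lborel \<partial>lborel)"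
  proof (rule nn_integral_mono)
    fix x :: 'a
    \<comment> \<open>With \<open>y = z + (x - grid h x)\<close> the sample point
      \<open>grid h x + y\<close> becomes \<open>x + z\<close>. The coordinates of
      \<open>x - grid h x\<close> lie in [0, h), so those of \<open>z\<close> lie strictly between
      \<open>- h\<close> and \<open>h\<close>.\<close>
    have "(\<integral>\<^sup>+y. tpow p (f x - f (grid h x + y)) * indicator ?Q y \<partial>lborel)
        = (\<integral>\<^sup>+z. tpow p (f x - f (grid h x + (z + (x - grid h x)))) * indicator ?Q (z + (x - grid h x)) \<partial>lborel)"
      by (rule nn_integral_lborel_translate[symmetric]) measurable
    also have "\<dots> \<le> (\<integral>\<^sup>+z. tpow p (f (x + z) - f x) * indicator ?Q' z \<partial>lborel)"
    proof (rule nn_integral_mono)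
      fix z :: 'a
      have "z \<in> ?Q'" if "z + (x - grid h x) \<in> ?Q"
        unfolding mem_box
      proof
        fix b :: 'a assume b: "b \<in> Basis"
        then have "0 < (z + (x - grid h x)) \<bullet> b" "(z + (x - grid h x)) \<bullet> b < h"
          using that by (auto simp: mem_box)
        then show "(- (h *\<^sub>R One)) \<bullet> b < z \<bullet> b \<and> z \<bullet> b < (h *\<^sub>R One) \<bullet> b"
          using diff_grid[OF h b, of x] b by (simp add: inner_add_left)
      qed
      then show "tpow p (f x - f (grid h x + (z + (x - grid h x)))) * indicator ?Q (z + (x - grid h x))
          \<le> tpow p (f (x + z) - f x) * indicator ?Q' z"
        by (auto simp: indicator_def tpow_minus_commute[of p "f x"] add.commute)
    qed
    finally show "(\<integral>\<^sup>+y. tpow p (f x - f (grid h x + y)) * indicator ?Q y \<partial>lborel)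
        \<le> (\<integral>\<^sup>+z. tpow p (f (x + z) - f x) * indicator ?Q' z \<partial>lborel)" .
  qed
  also have "\<dots> = (\<integral>\<^sup>+z. \<integral>\<^sup>+x. tpow p (f (x + z) - f x) * indicator ?Q' z \<partial>lborel \<partial>lborel)"
    by (rule lborel_pair.Fubini[where f = "\<lambda>(z, x). tpow p (f (x + z) - f x) * indicator ?Q' z", unfolded case_prod_conv])
      measurable
  also have "\<dots> = (\<integral>\<^sup>+z. modular p (\<lambda>x. f (x + z) - f x) * indicator ?Q' z \<partial>lborel)"
    unfolding modular_def by (intro nn_integral_cong nn_integral_multc) measurable
  also have "\<dots> \<le> (\<integral>\<^sup>+z. ennreal e * indicator ?Q' z \<partial>lborel)"
    by (intro nn_integral_mono) (auto simp: indicator_def tr simp del: mem_box)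
  also have "\<dots> = ?c * ennreal (h ^ DIM('a))"
    by (simp add: nn_integral_cmult_indicator Q' ac_simps)
  finally have "2 * (?c * ennreal (h ^ DIM('a))) \<le> ?c * ennreal (h ^ DIM('a))" by (simp add: mult.assoc)
  moreover define c where "c = 2 ^ DIM('a) * e * h ^ DIM('a)"
  moreover have "?c * ennreal (h ^ DIM('a)) = ennreal c"
    using h e by (simp add: c_def ennreal_mult ennreal_power[symmetric])
  ultimately have "ennreal (2 * c) \<le> ennreal c"
    by (simp add: ennreal_mult')
  moreover have "0 < c" using h e by (simp add: c_def)
  ultimately show False by simp
qed

section \<open>Finitely many patterns for a uniformly bounded family\<close>

text \<open>The signature lists the rounded values of the step function on the cubes that meet a
  large ball. Equal signatures make the two step functions close on the ball, each is close to its
  own function, and off the ball both tails are small. \<open>E\<close> is the sampling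
  loss.\<close>

lemma bounded_finite_signature:
  fixes u :: "'i \<Rightarrow> 'a::euclidean_space \<Rightarrow> real" and p M :: real
  defines "E \<equiv> 2 * 2 ^ DIM('a)"
  assumes p: "1 \<le> p" and e: "0 < e"
    and meas: "\<And>i. i \<in> S \<Longrightarrow> u i \<in> borel_measurable borel"
    and bound: "\<And>i x. i \<in> S \<Longrightarrow> \<bar>u i x\<bar> \<le> M"
    and tails: "\<forall>\<^sub>F R in at_top. \<forall>i\<in>S. tail p R (u i) \<le> ennreal e"
    and trans: "\<forall>\<^sub>F y in at 0. \<forall>i\<in>S. modular p (\<lambda>x. u i (x + y) - u i x) \<le> ennreal e"
  obtains \<sigma> :: "'i \<Rightarrow> 'a \<Rightarrow> int" where "finite (\<sigma> ` S)"
    "\<And>i j. i \<in> S \<Longrightarrow> j \<in> S \<Longrightarrow> \<sigma> i = \<sigma> j \<Longrightarrow>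
      modular p (\<lambda>x. u i x - u j x) \<le> quasi p * (E + quasi p * (1 + E) + 2) * ennreal e"
proof -
  define C where "C = quasi p"
  obtain R where R: "\<And>i. i \<in> S \<Longrightarrow> tail p R (u i) \<le> ennreal e"
    using tails by (auto simp: eventually_at_top_linorder)
  obtain d where d: "0 < d"
    "\<And>y i. y \<noteq> 0 \<Longrightarrow> norm y < d \<Longrightarrow> i \<in> S \<Longrightarrow> modular p (\<lambda>x. u i (x + y) - u i x) \<le> ennreal e"
    using trans by (auto simp: eventually_at)
  \<comment> \<open>For \<open>z\<close> in the box of half-width \<open>h\<close> the l1 norm,
    hence the norm, is at most \<open>DIM('a) * h = d / 2\<close>.\<close>
  define h where "h = d / (2 * DIM('a))"
  have h: "0 < h" using d by (simp add: h_def)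
  have "\<exists>y. modular p (\<lambda>x. u i x - u i (grid h x + y)) \<le> E * ennreal e" if i: "i \<in> S" for i
  proof -
    have "modular p (\<lambda>x. u i (x + z) - u i x) \<le> ennreal e"
      if z: "z \<in> box (- (h *\<^sub>R One)) (h *\<^sub>R One)" for z
    proof (cases "z = 0")
      \<comment> \<open>The filter \<open>at 0\<close> gives no information at the zero shift, where
        the modulus vanishes anyway.\<close>
      case True then show ?thesis by (simp add: modular_def)
    next
      case False
      have "norm z \<le> (\<Sum>b\<in>Basis. \<bar>z \<bullet> b\<bar>)" by (rule norm_le_l1)
      also have "\<dots> \<le> (\<Sum>b\<in>(Basis::'a set). h)"
      proof (rule sum_mono)
        fix b :: 'a assume "b \<in> Basis"
        then have "- h < z \<bullet> b \<and> z \<bullet> b < h" using z by (auto simp: mem_box)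
        then show "\<bar>z \<bullet> b\<bar> \<le> h" by linarith
      qed
      also have "\<dots> < d" using d by (simp add: h_def)
      finally show ?thesis using d(2) False i by blast
    qed
    then show ?thesis using grid_sampling[OF meas[OF i] h e, of p] unfolding E_def by blast
  qed
  then obtain y where y: "\<And>i. i \<in> S \<Longrightarrow> modular p (\<lambda>x. u i x - u i (grid h x + y i)) \<le> E * ennreal e"
    by metis
  \<comment> \<open>The rounding error integrated over the ball must not exceed \<open>e\<close>;
    the 1 keeps the denominator positive when the ball is null.\<close>
  define \<eta> where "\<eta> = e / (measure lborel (cball (0::'a) R) + 1)"
  have eta: "0 < \<eta>" using e by (simp add: \<eta>_def add_nonneg_pos)
  have eta_int: "ennreal \<eta> * emeasure lborel (cball (0::'a) R) \<le> ennreal e"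
  proof -
    have "emeasure lborel (cball (0::'a) R) = ennreal (measure lborel (cball (0::'a) R))"
      using emeasure_lborel_cball_finite[of "0::'a" R] by (intro emeasure_eq_ennreal_measure) auto
    moreover have "\<eta> * measure lborel (cball (0::'a) R) \<le> e"
      using e by (simp add: \<eta>_def divide_le_eq add_nonneg_pos mult_left_mono)
    ultimately show ?thesis using eta by (simp add: ennreal_mult[symmetric] ennreal_leI)
  qed
  \<comment> \<open>The offset \<open>y i\<close> is not recorded: only the value attached to each
    cube matters for comparing two step functions. Restricting to the finitely many corners makes
    \<open>\<sigma> i\<close> an element of a finite \<open>PiE\<close>.\<close>
  define \<sigma> where "\<sigma> i = (\<lambda>q\<in>grid h ` cball 0 R. \<lfloor>u i (q + y i) / \<eta>\<rfloor>)" for i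
  show thesis
  proof (rule that)
    have "\<sigma> i \<in> PiE (grid h ` cball 0 R) (\<lambda>_. {\<lfloor>- M / \<eta>\<rfloor>..\<lfloor>M / \<eta>\<rfloor>})" if i: "i \<in> S" for i
    proof -
      have "- M / \<eta> \<le> u i x / \<eta> \<and> u i x / \<eta> \<le> M / \<eta>" for x
        using bound[OF i, of x] eta by (intro conjI divide_right_mono) linarith+
      then show ?thesis unfolding \<sigma>_def by (intro PiE_I) (auto intro!: floor_mono simp del: minus_divide_left)
    qed
    then have "\<sigma> ` S \<subseteq> PiE (grid h ` cball 0 R) (\<lambda>_. {\<lfloor>- M / \<eta>\<rfloor>..\<lfloor>M / \<eta>\<rfloor>})"
      by (rule image_subsetI)
    then show "finite (\<sigma> ` S)"
      by (rule finite_subset) (intro finite_PiE finite_grid_cball h finite_atLeastAtMost_int)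
  next
    fix i j assume i: "i \<in> S" and j: "j \<in> S" and eq: "\<sigma> i = \<sigma> j"
    note [measurable] = meas[OF i] meas[OF j]
    define a where "a l x = tpow p (u l x - u l (grid h x + y l))" for l x
    define t where "t l x = tpow p (u l x) * indicator {x. norm x > R} x" for l x
    have [measurable]: "a i \<in> borel_measurable borel" "a j \<in> borel_measurable borel"
      "t i \<in> borel_measurable borel" "t j \<in> borel_measurable borel"
      unfolding a_def t_def by measurable
    \<comment> \<open>On the ball the path leads from \<open>u i\<close> to its samples, to those of
      \<open>u j\<close>, to \<open>u j\<close>; equal floors keep the middle leg within
      \<open>\<eta>\<close>. Off the ball it passes through 0.\<close>
    have pt: "tpow p (u i x - u j x) \<le> C * (a i x + C * (ennreal \<eta> * indicator (cball 0 R) x + a j x)) + C * (t i x + t j x)"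
      for x
    proof (cases "norm x \<le> R")
      case True
      let ?r = "u i (grid h x + y i)" and ?s = "u j (grid h x + y j)"
      have "\<lfloor>?r / \<eta>\<rfloor> = \<lfloor>?s / \<eta>\<rfloor>"
        using fun_cong[OF eq, of "grid h x"] True by (auto simp: \<sigma>_def)
      then have "\<bar>?r / \<eta> - ?s / \<eta>\<bar> < 1" by linarith
      then have "\<bar>?r - ?s\<bar> \<le> \<eta>"
        using eta by (simp add: diff_divide_distrib[symmetric] abs_divide)
      then have "tpow p (?r - ?s) \<le> ennreal \<eta>"
        using tpow_le_abs[OF p, of "?r - ?s"] by (meson ennreal_leI order_trans)
      then have "tpow p (?r - u j x) \<le> C * (ennreal \<eta> + tpow p (?s - u j x))"
        unfolding C_def by (rule tpow_diff_le[OF p _ order_refl])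
      then have "tpow p (u i x - u j x) \<le> C * (tpow p (u i x - ?r) + C * (ennreal \<eta> + tpow p (?s - u j x)))"
        unfolding C_def by (rule tpow_diff_le[OF p order_refl])
      then show ?thesis using True
        by (simp add: a_def add_increasing2 tpow_minus_commute[of p _ "u j x"])
    next
      case False
      then have "t i x = tpow p (u i x - 0)" "t j x = tpow p (0 - u j x)" by (auto simp: t_def)
      then show ?thesis
        using tpow_diff_triangle[OF p, of "u i x" "u j x" 0] by (simp add: C_def add_increasing)
    qed
    have "modular p (\<lambda>x. u i x - u j x)
        \<le> (\<integral>\<^sup>+x. C * (a i x + C * (ennreal \<eta> * indicator (cball 0 R) x + a j x)) + C * (t i x + t j x) \<partial>lborel)"
      unfolding modular_def by (intro nn_integral_mono pt)
    also have "\<dots> = C * ((\<integral>\<^sup>+x. a i x \<partial>lborel)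
        + C * (ennreal \<eta> * emeasure lborel (cball (0::'a) R) + (\<integral>\<^sup>+x. a j x \<partial>lborel)))
        + C * ((\<integral>\<^sup>+x. t i x \<partial>lborel) + (\<integral>\<^sup>+x. t j x \<partial>lborel))"
      by (simp add: nn_integral_add nn_integral_cmult nn_integral_cmult_indicator)
    also have "\<dots> \<le> C * (E * ennreal e + C * (ennreal e + E * ennreal e)) + C * (ennreal e + ennreal e)"
      using y[OF i] y[OF j] R[OF i] R[OF j] eta_int
      unfolding a_def t_def tail_def modular_def
      by (intro add_mono mult_left_mono) auto
    also have "\<dots> = C * (E + C * (1 + E) + 2) * ennreal e"
      by (simp add: algebra_simps flip: mult_2)
    finally show "modular p (\<lambda>x. u i x - u j x) \<le> quasi p * (E + quasi p * (1 + E) + 2) * ennreal e"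
      unfolding C_def .
  qed
qed

text \<open>\<open>inv_into\<close> selects one member of \<open>S\<close> for each value of
  \<open>\<sigma>\<close>, so the net lies inside the family.\<close>

lemma finite_net_of_finite_image:
  assumes "finite (\<sigma> ` S)" "\<And>i j. i \<in> S \<Longrightarrow> j \<in> S \<Longrightarrow> \<sigma> i = \<sigma> j \<Longrightarrow> P i j"
  shows "\<exists>K. finite K \<and> K \<subseteq> S \<and> (\<forall>i\<in>S. \<exists>k\<in>K. P i k)"
proof (intro exI conjI ballI)
  let ?K = "inv_into S \<sigma> ` \<sigma> ` S"
  show "finite ?K" "?K \<subseteq> S" using assms(1) by (auto intro: inv_into_into)
  fix i assume "i \<in> S"
  then show "\<exists>k\<in>?K. P i k"
    by (intro bexI[of _ "inv_into S \<sigma> (\<sigma> i)"] assms(2)) (auto intro: inv_into_into simp: f_inv_into_f)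
qed

section \<open>Clipping, and the equivalence for Borel functions\<close>

definition clip :: "real \<Rightarrow> real \<Rightarrow> real" where
  "clip M t = max (- M) (min M t)"

lemma clip_measurable [measurable]: "clip M \<in> borel_measurable borel"
  unfolding clip_def by measurable

lemma abs_clip_le: "0 \<le> M \<Longrightarrow> \<bar>clip M t\<bar> \<le> M" "0 \<le> M \<Longrightarrow> \<bar>clip M t\<bar> \<le> \<bar>t\<bar>"
  unfolding clip_def by (smt (verit))+

lemma clip_nonexpansive: "\<bar>clip M s - clip M t\<bar> \<le> \<bar>s - t\<bar>"
  unfolding clip_def by (smt (verit))

text \<open>Clipping changes \<open>f\<close> only on the superlevel set, and there the integrand is
  at most 1.\<close>

lemma modular_clip_le:
  fixes f :: "'a::euclidean_space \<Rightarrow> real"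
  assumes p: "1 \<le> p" and [measurable]: "f \<in> borel_measurable borel"
  shows "modular p (\<lambda>x. f x - clip M (f x)) \<le> emeasure lborel {x. \<bar>f x\<bar> > M}"
proof -
  have "modular p (\<lambda>x. f x - clip M (f x)) \<le> (\<integral>\<^sup>+x. indicator {x. \<bar>f x\<bar> > M} x \<partial>lborel)"
    unfolding modular_def
    by (intro nn_integral_mono) (auto simp: indicator_def tpow_le_1[OF p] clip_def)
  then show ?thesis by simp
qed

text \<open>The theorem for Borel functions, with finite nets for \<open>modular\<close> in place of
  total boundedness.\<close>

lemma finite_nets_iff:
  fixes u :: "'i \<Rightarrow> 'a::euclidean_space \<Rightarrow> real"
  assumes p: "1 \<le> p"
    and meas: "\<And>i. i \<in> S \<Longrightarrow> u i \<in> borel_measurable borel"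
    and fin: "\<And>i. i \<in> S \<Longrightarrow> modular p (u i) < \<infinity>"
  shows "(\<forall>e::real>0. \<exists>K. finite K \<and> K \<subseteq> S \<and> (\<forall>i\<in>S. \<exists>k\<in>K. modular p (\<lambda>x. u i x - u k x) \<le> ennreal e))
    \<longleftrightarrow> ((\<lambda>R. SUP i\<in>S. tail p R (u i)) \<longlongrightarrow> 0) at_top
      \<and> ((\<lambda>y. SUP i\<in>S. modular p (\<lambda>x. u i (x + y) - u i x)) \<longlongrightarrow> 0) (at 0)
      \<and> ((\<lambda>M. SUP i\<in>S. emeasure lborel {x. \<bar>u i x\<bar> > M}) \<longlongrightarrow> 0) at_top"
    (is "?net \<longleftrightarrow> ?tails \<and> ?trans \<and> ?levels")
proof (intro iffI conjI)
  assume ?net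
  then have net: "\<exists>K. finite K \<and> K \<subseteq> S \<and> (\<forall>i\<in>S. \<exists>k\<in>K. modular p (\<lambda>x. u i x - u k x) \<le> ennreal e)"
    if "0 < e" for e :: real using that by blast
  note net_rule = SUP_tendsto_0_finite_net[OF _ net]
  show ?tails
    by (rule net_rule[where B = "quasi p" and T' = "\<lambda>R k. tail p R (u k)"])
      (auto intro!: tail_tendsto_0 tail_triangle meas p fin[unfolded infinity_ennreal_def])
  show ?trans
    by (rule net_rule[where B = "quasi p * (1 + quasi p)" and T' = "\<lambda>y k. modular p (\<lambda>x. u k (x + y) - u k x)"])
      (auto intro!: translation_tendsto_0 translation_triangle meas p fin[unfolded infinity_ennreal_def]
        simp: ennreal_mult_less_top)
  show ?levels
  \<comment> \<open>The level drops by 1 as in \<open>superlevel_le\<close>, which is harmless as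
    \<open>M\<close> tends to infinity.\<close>
  proof (rule net_rule[where B = 1 and T' = "\<lambda>M k. emeasure lborel {x. \<bar>u k x\<bar> > M - 1}"])
    fix k assume k: "k \<in> S"
    have "filterlim (\<lambda>M::real. M - 1) at_top at_top"
      using filterlim_tendsto_add_at_top[OF tendsto_const[of "- 1 :: real"] filterlim_ident] by simp
    with superlevel_tendsto_0[OF meas[OF k] fin[OF k]]
    show "((\<lambda>M. emeasure lborel {x. \<bar>u k x\<bar> > M - 1}) \<longlongrightarrow> 0) at_top"
      by (rule filterlim_compose)
  qed (auto intro!: superlevel_le meas)
next
  assume "?tails \<and> ?trans \<and> ?levels"
  then have tails: "\<forall>\<^sub>F R in at_top. \<forall>i\<in>S. tail p R (u i) \<le> ennreal e"
    and trans: "\<forall>\<^sub>F y in at 0. \<forall>i\<in>S. modular p (\<lambda>x. u i (x + y) - u i x) \<le> ennreal e"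
    and levels: "\<forall>\<^sub>F M in at_top. \<forall>i\<in>S. emeasure lborel {x. \<bar>u i x\<bar> > M} \<le> ennreal e"
    if "0 < e" for e :: real
    using that unfolding SUP_tendsto_0_iff by blast+
  show ?net
  proof (intro allI impI)
    fix r :: real assume r: "0 < r"
    define C where "C = quasi p"
    define E :: ennreal where "E = 2 * 2 ^ DIM('a)"
    define B where "B = C * (E + C * (1 + E) + 2)"
    have C: "C < top" "E < top" by (auto simp: C_def E_def ennreal_mult_less_top power_less_top_ennreal)
    have "C * (1 + C * (B + 1)) < \<infinity>"
      using C by (simp add: B_def ennreal_mult_less_top)
    moreover have "0 < ennreal r" using r by simp
    \<comment> \<open>The factor is the cost of passing from \<open>u i\<close> to its clipping, to
      that of \<open>u j\<close>, to \<open>u j\<close>. It depends only on \<open>p\<close> and the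
      dimension, so \<open>e\<close> can be fixed before the clipping level.\<close>
    ultimately obtain e :: real where e: "0 < e" and er: "C * (1 + C * (B + 1)) * ennreal e < ennreal r"
      by (rule ennreal_arbitrarily_small)
    have "\<forall>\<^sub>F M in at_top. (\<forall>i\<in>S. emeasure lborel {x. \<bar>u i x\<bar> > M} \<le> ennreal e) \<and> 0 \<le> M"
      using levels[OF e] eventually_ge_at_top by (rule eventually_conj)
    then obtain M where M: "0 \<le> M" "\<And>i. i \<in> S \<Longrightarrow> emeasure lborel {x. \<bar>u i x\<bar> > M} \<le> ennreal e"
      by (auto simp: eventually_at_top_linorder)
    define v where "v i x = clip M (u i x)" for i x
    have vmeas: "v i \<in> borel_measurable borel" if "i \<in> S" for i
      using meas[OF that] unfolding v_def by measurable
    have uv: "modular p (\<lambda>x. u i x - v i x) \<le> ennreal e" if "i \<in> S" for i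
      using modular_clip_le[OF p meas[OF that], of M] M(2)[OF that] unfolding v_def by (rule order_trans)
    have vtails: "\<forall>\<^sub>F R in at_top. \<forall>i\<in>S. tail p R (v i) \<le> ennreal e"
      using tails[OF e]
    proof eventually_elim
      case (elim R)
      have "tail p R (v i) \<le> tail p R (u i)" for i
        unfolding tail_def v_def by (intro nn_integral_mono mult_right_mono tpow_mono p abs_clip_le M(1)) simp
      then show ?case using elim order_trans by blast
    qed
    have vtrans: "\<forall>\<^sub>F y in at 0. \<forall>i\<in>S. modular p (\<lambda>x. v i (x + y) - v i x) \<le> ennreal e"
      using trans[OF e]
    proof eventually_elim
      case (elim y)
      have "modular p (\<lambda>x. v i (x + y) - v i x) \<le> modular p (\<lambda>x. u i (x + y) - u i x)" for i
        unfolding modular_def v_def by (intro nn_integral_mono tpow_mono p clip_nonexpansive)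
      then show ?case using elim order_trans by blast
    qed
    have vbound: "\<bar>v i x\<bar> \<le> M" for i x using M(1) by (simp add: v_def abs_clip_le)
    obtain \<sigma> :: "'i \<Rightarrow> 'a \<Rightarrow> int" where \<sigma>: "finite (\<sigma> ` S)"
      "\<And>i j. i \<in> S \<Longrightarrow> j \<in> S \<Longrightarrow> \<sigma> i = \<sigma> j \<Longrightarrow> modular p (\<lambda>x. v i x - v j x) \<le> B * ennreal e"
      by (rule bounded_finite_signature[OF p e vmeas vbound vtails vtrans]) (auto simp: B_def C_def E_def)
    show "\<exists>K. finite K \<and> K \<subseteq> S \<and> (\<forall>i\<in>S. \<exists>k\<in>K. modular p (\<lambda>x. u i x - u k x) \<le> ennreal r)"
    proof (rule finite_net_of_finite_image[OF \<sigma>(1)])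
      fix i j assume i: "i \<in> S" and j: "j \<in> S" and eq: "\<sigma> i = \<sigma> j"
      have "modular p (\<lambda>x. u i x - u j x) \<le> C * (modular p (\<lambda>x. u i x - v i x) + modular p (\<lambda>x. v i x - u j x))"
        unfolding C_def by (intro modular_triangle p meas vmeas i j)
      also have "modular p (\<lambda>x. v i x - u j x) \<le> C * (modular p (\<lambda>x. v i x - v j x) + modular p (\<lambda>x. v j x - u j x))"
        unfolding C_def by (intro modular_triangle p meas vmeas i j)
      also have "modular p (\<lambda>x. v j x - u j x) = modular p (\<lambda>x. u j x - v j x)"
        by (rule modular_minus_commute)
      finally have "modular p (\<lambda>x. u i x - u j x) \<le> C * (modular p (\<lambda>x. u i x - v i x)
          + C * (modular p (\<lambda>x. v i x - v j x) + modular p (\<lambda>x. u j x - v j x)))"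
        by (simp add: mult_left_mono)
      also have "\<dots> \<le> C * (ennreal e + C * (B * ennreal e + ennreal e))"
        by (intro mult_left_mono add_mono uv \<sigma>(2) i j eq) auto
      also have "\<dots> = C * (1 + C * (B + 1)) * ennreal e" by (simp add: algebra_simps)
      finally show "modular p (\<lambda>x. u i x - u j x) \<le> ennreal r" using er by simp
    qed
  qed
qed

section \<open>From Borel functions to classes and their metric\<close>

text \<open>\<open>D\<close> stands for the p-th power of the metric. Finiteness lets
  \<open>enn2real\<close> preserve comparisons, and the root is strictly increasing, so metric balls
  correspond to sublevel sets of \<open>D\<close>.\<close>

lemma mtotally_bounded_Lambda_iff:
  assumes p: "1 \<le> p" and F: "\<F> \<subseteq> Lambda p"
    and fin: "\<And>f g. f \<in> \<F> \<Longrightarrow> g \<in> \<F> \<Longrightarrow> D f g < \<infinity>"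
    and dist: "\<And>f g. f \<in> \<F> \<Longrightarrow> g \<in> \<F> \<Longrightarrow> Lambda_dist p f g = enn2real (D f g) powr (1 / p)"
  shows "Metric_space.mtotally_bounded (Lambda p) (Lambda_dist p) \<F>
    \<longleftrightarrow> (\<forall>e::real>0. \<exists>K. finite K \<and> K \<subseteq> \<F> \<and> (\<forall>f\<in>\<F>. \<exists>k\<in>K. D f k \<le> ennreal e))"
    (is "_ \<longleftrightarrow> ?net")
proof -
  interpret Metric_space "Lambda p" "Lambda_dist p" by (rule Metric_space_Lambda[OF p])
  have small: "Lambda_dist p f g < e powr (1 / p) \<longleftrightarrow> D f g < ennreal e"
    if "f \<in> \<F>" "g \<in> \<F>" "0 < e" for f g e
  proof -
    have "enn2real (D f g) powr (1 / p) < e powr (1 / p) \<longleftrightarrow> enn2real (D f g) < e"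
      using p that(3) powr_less_mono2[of "1 / p" "enn2real (D f g)" e]
        powr_mono2[of "1 / p" e "enn2real (D f g)"] enn2real_nonneg[of "D f g"]
      by (auto simp: not_less[symmetric])
    also have "\<dots> \<longleftrightarrow> D f g < ennreal e"
      using fin[OF that(1,2)] that(3) by (cases "D f g") (auto simp: ennreal_less_iff)
    finally show ?thesis using dist that by simp
  qed
  show ?thesis
  proof
    assume L: "mtotally_bounded \<F>"
    show ?net
    proof (intro allI impI)
      fix e :: real assume e: "0 < e"
      then obtain K where K: "finite K" "K \<subseteq> \<F>" "\<F> \<subseteq> (\<Union>k\<in>K. mball k (e powr (1 / p)))"
        using L[unfolded mtotally_bounded_def, rule_format, of "e powr (1 / p)"] by auto
      have "\<exists>k\<in>K. D f k \<le> ennreal e" if f: "f \<in> \<F>" for f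
      proof -
        obtain k where "k \<in> K" "Lambda_dist p k f < e powr (1 / p)" using K(3) f by auto
        then show ?thesis using small[OF f _ e, of k] K(2) by (auto simp: commute intro: less_imp_le)
      qed
      then show "\<exists>K. finite K \<and> K \<subseteq> \<F> \<and> (\<forall>f\<in>\<F>. \<exists>k\<in>K. D f k \<le> ennreal e)" using K by blast
    qed
  next
    assume R: ?net
    show "mtotally_bounded \<F>"
      unfolding mtotally_bounded_def
    proof (intro allI impI)
      fix r :: real assume r: "0 < r"
      define e where "e = r powr p"
      have e: "0 < e" "e powr (1 / p) = r" using r p by (auto simp: e_def powr_powr)
      \<comment> \<open>Halving \<open>e\<close> turns the weak bound of the net into the strict one
        of an open ball.\<close>
      obtain K where K: "finite K" "K \<subseteq> \<F>" "\<And>f. f \<in> \<F> \<Longrightarrow> \<exists>k\<in>K. D f k \<le> ennreal (e / 2)"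
        using R e(1) by (meson half_gt_zero)
      have "f \<in> (\<Union>k\<in>K. mball k r)" if f: "f \<in> \<F>" for f
      proof -
        obtain k where k: "k \<in> K" "D f k \<le> ennreal (e / 2)" using K(3) f by blast
        have "D f k < ennreal e" by (rule le_less_trans[OF k(2)]) (use e(1) in \<open>simp add: ennreal_less_iff\<close>)
        then have "Lambda_dist p f k < r" using small[OF f _ e(1)] k(1) K(2) e(2) by auto
        then have "f \<in> mball k r" using k(1) K(2) F f by (auto simp: commute[of k f])
        then show ?thesis using k(1) by blast
      qed
      then show "\<exists>K. finite K \<and> K \<subseteq> \<F> \<and> \<F> \<subseteq> (\<Union>k\<in>K. mball k r)" using K by blast
    qed
  qed
qed

text \<open>Translation preserves \<open>lborel\<close>, hence null sets. The translation condition
  evaluates a representative at \<open>x + y\<close> as well as at \<open>x\<close>, so its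
  exceptional set must be moved along.\<close>

lemma AE_lborel_translate:
  fixes y :: "'a::euclidean_space"
  assumes "AE x in lborel. P x" shows "AE x in lborel. P (x + y)"
proof -
  obtain N where N: "{x \<in> space lborel. \<not> P x} \<subseteq> N" "emeasure lborel N = 0" "N \<in> sets lborel"
    using assms by (rule AE_E)
  then have "AE x in distr lborel borel ((+) y). x \<notin> N"
    by (subst lborel_distr_plus) (auto intro!: AE_not_in null_setsI)
  then have "AE x in lborel. y + x \<notin> N"
    using N(3) by (subst (asm) AE_distr_iff) auto
  then show ?thesis by eventually_elim (use N(1) in \<open>auto simp: add.commute\<close>)
qed

theorem theorem4p2:
  fixes p :: real and \<F> :: "(real ^ 'n \<Rightarrow> real) set set"
  assumes "1 \<le> p" and "\<F> \<subseteq> Lambda p"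
  shows "Metric_space.mtotally_bounded (Lambda p) (Lambda_dist p) \<F> \<longleftrightarrow>
     ((\<lambda>R::real. SUP f\<in>\<F>. \<integral>\<^sup>+x\<in>{x. norm x > R}. ennreal (min \<bar>rep f x\<bar> 1 powr p) \<partial>lebesgue)
        \<longlongrightarrow> 0) at_top
   \<and> ((\<lambda>y. SUP f\<in>\<F>. \<integral>\<^sup>+x. ennreal (min \<bar>rep f (x + y) - rep f x\<bar> 1 powr p) \<partial>lebesgue)
        \<longlongrightarrow> 0) (at 0)
   \<and> ((\<lambda>M::real. SUP f\<in>\<F>. emeasure lebesgue {x. \<bar>rep f x\<bar> > M}) \<longlongrightarrow> 0) at_top"
proof -
  have repL: "rep f \<in> Lambda_fun p" if "f \<in> \<F>" for f
    using rep_in Lambda_subset assms(2) that by blast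
  then have rep_meas: "rep f \<in> borel_measurable lebesgue" if "f \<in> \<F>" for f
    using that by (auto simp: Lambda_fun_def)
  \<comment> \<open>Distances and all three conditions are insensitive to null sets, so each
    representative may be exchanged for a Borel function; \<open>diff\<close>, \<open>tails\<close>,
    \<open>trans\<close> and \<open>levels\<close> carry this out.\<close>
  have "\<exists>g\<in>borel_measurable borel. AE x in lborel. rep f x = g x" if "f \<in> \<F>" for f
    using completion_ex_borel_measurable_real[OF rep_meas[OF that]] by simp
  then obtain u where u: "\<And>f. f \<in> \<F> \<Longrightarrow> u f \<in> borel_measurable borel"
    and ae: "\<And>f. f \<in> \<F> \<Longrightarrow> AE x in lborel. rep f x = u f x"
    by metis
  have diff: "(\<integral>\<^sup>+x. ennreal (min \<bar>rep f x - rep g x\<bar> 1 powr p) \<partial>lebesgue) = modular p (\<lambda>x. u f x - u g x)"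
    if "f \<in> \<F>" "g \<in> \<F>" for f g
    unfolding modular_def tpow_def nn_integral_completion
    by (rule nn_integral_cong_AE) (use ae[OF that(1)] ae[OF that(2)] in eventually_elim, simp)
  have fin: "modular p (u f) < \<infinity>" if "f \<in> \<F>" for f
  proof -
    have "modular p (u f) = (\<integral>\<^sup>+x. ennreal (min \<bar>rep f x\<bar> 1 powr p) \<partial>lebesgue)"
      unfolding modular_def tpow_def nn_integral_completion
      by (rule nn_integral_cong_AE) (use ae[OF that] in eventually_elim, simp)
    then show ?thesis using repL[OF that] by (simp add: Lambda_fun_def)
  qed
  have tails: "(\<integral>\<^sup>+x\<in>{x. norm x > R}. ennreal (min \<bar>rep f x\<bar> 1 powr p) \<partial>lebesgue) = tail p R (u f)"
    if "f \<in> \<F>" for f R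
    unfolding tail_def tpow_def nn_integral_completion
    by (rule nn_integral_cong_AE) (use ae[OF that] in eventually_elim, simp)
  have trans: "(\<integral>\<^sup>+x. ennreal (min \<bar>rep f (x + y) - rep f x\<bar> 1 powr p) \<partial>lebesgue)
      = modular p (\<lambda>x. u f (x + y) - u f x)" if "f \<in> \<F>" for f y
    unfolding modular_def tpow_def nn_integral_completion
    by (rule nn_integral_cong_AE)
      (use ae[OF that] AE_lborel_translate[OF ae[OF that], of y] in eventually_elim, simp)
  have levels: "emeasure lebesgue {x. \<bar>rep f x\<bar> > M} = emeasure lborel {x. \<bar>u f x\<bar> > M}"
    if f: "f \<in> \<F>" for f M
  proof -
    note [measurable] = u[OF f] rep_meas[OF f]
    have uM: "{x. \<bar>u f x\<bar> > M} \<in> sets borel" by measurable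
    have "{x \<in> space lebesgue. \<bar>rep f x\<bar> > M} \<in> sets lebesgue" by measurable
    then have "emeasure lebesgue {x. \<bar>rep f x\<bar> > M} = emeasure lebesgue {x. \<bar>u f x\<bar> > M}"
      using AE_completion[OF ae[OF f]] uM by (intro emeasure_eq_AE) (auto elim!: eventually_mono)
    then show ?thesis using uM by simp
  qed
  have "Metric_space.mtotally_bounded (Lambda p) (Lambda_dist p) \<F> \<longleftrightarrow> (\<forall>e::real>0. \<exists>K. finite K \<and> K \<subseteq> \<F>
      \<and> (\<forall>f\<in>\<F>. \<exists>k\<in>K. modular p (\<lambda>x. u f x - u k x) \<le> ennreal e))"
  proof (rule mtotally_bounded_Lambda_iff[OF assms])
    fix f g assume fg: "f \<in> \<F>" "g \<in> \<F>"
    show "modular p (\<lambda>x. u f x - u g x) < \<infinity>"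
      using Lambda_fun_diff[OF assms(1) repL[OF fg(1)] repL[OF fg(2)]] diff[OF fg] by simp
    show "Lambda_dist p f g = enn2real (modular p (\<lambda>x. u f x - u g x)) powr (1 / p)"
      by (simp add: Lambda_dist_def Lp_norm_def diff[OF fg])
  qed
  also have "\<dots> \<longleftrightarrow> ((\<lambda>R. SUP f\<in>\<F>. tail p R (u f)) \<longlongrightarrow> 0) at_top
      \<and> ((\<lambda>y. SUP f\<in>\<F>. modular p (\<lambda>x. u f (x + y) - u f x)) \<longlongrightarrow> 0) (at 0)
      \<and> ((\<lambda>M. SUP f\<in>\<F>. emeasure lborel {x. \<bar>u f x\<bar> > M}) \<longlongrightarrow> 0) at_top"
    by (rule finite_nets_iff[OF assms(1) u fin])
  finally show ?thesis
    by (simp add: tails trans levels cong: SUP_cong)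
qed

end
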